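(* Let $f(x)=\sum_{i=1}^m f_i(x_{\Delta_i})$ be a real polynomial in $x=(x_1,\dots,x_n)$, where $\Delta_i\subset\{1,\dots,n\}$ with $\bigcup_i\Delta_i=\{1,\dots,n\}$, each $f_i\in\mathbb{R}[x_{\Delta_i}]$ has even degree $2d_i$, and $\deg f=2d=\max_i2d_i$. Suppose $y^*$ is an optimal solution of the sparse moment relaxation $$\min_{y}\ \sum_{\alpha\in\mathcal{F}}f_\alpha y_\alpha\quad\text{s.t.}\quad \mathcal{M}_d^{\Delta_i}(y)\succeq0\ (i=1,\dots,m),\quad y_0=1,$$ such that all the matrices $\mathcal{M}_d^{\Delta_i}(y^* )$, $i=1,\dots,m$, satisfy the flat extension condition. Then any $x^*=(x^*_1,\dots,x^*_n)\in\mathbb{R}^n$ with $x^*_k\in\mathcal{V}_k$ for all $k=1,\dots,n$ and $x^*_{\Delta_i}\in\mathcal{X}_{\Delta_i}$ for all $i=1,\dots,m$ is a global minimizer of $f$ over $\mathbb{R}^n$.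
   Context: Notation: for $\Delta\subset\{1,\dots,n\}$, $x_\Delta=(x_j)_{j\in\Delta}$, and $\mathbf{m}_d(x_\Delta)$ is the column vector of all monomials in $x_\Delta$ of degree at most $d$. For $\alpha\in\mathbb{N}^n$, $|\alpha|=\sum_j\alpha_j$, $\mathrm{supp}(\alpha)=\{j:\alpha_j\ne0\}$. Write $f=\sum_\alpha f_\alpha x^\alpha$. $\mathcal{F}_i=\{\alpha\in\mathbb{N}^n:\mathrm{supp}(\alpha)\subset\Delta_i,|\alpha|\le2d\}$, $\mathcal{F}=\bigcup_i\mathcal{F}_i$, $y=(y_\alpha)_{\alpha\in\mathcal{F}}$. For $\Delta$ contained in some $\Delta_i$ and $k\le d$, $\mathcal{M}_k^{\Delta}(y)$ is the matrix indexed by $\{\alpha:\mathrm{supp}(\alpha)\subset\Delta,|\alpha|\le k\}$ with entries $\mathcal{M}_k^{\Delta}(y)(\alpha,\beta)=y_{\alpha+\beta}$. Flat extension condition for $\mathcal{M}_d^{\Delta}(y)$: $\mathrm{rank}\,\mathcal{M}_k^{\Delta}(y)=\mathrm{rank}\,\mathcal{M}_{k+1}^{\Delta}(y)$ for some $0\le k\le d-1$. Atomic representing support: a finite set $\{u_1,\dots,u_r\}\subset\mathbb{R}^{\Delta}$ is an ($r$-)atomic representing support for $\mathcal{M}_d^\Delta(y)$ if $\mathcal{M}_d^{\Delta}(y)=\sum_{\ell=1}^r\lambda_\ell\,\mathbf{m}_d(u_\ell)\mathbf{m}_d(u_\ell)^T$ for some $\lambda_\ell>0$ with $\sum_\ell\lambda_\ell=1$.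 Extracted points: $\mathcal{X}_{\Delta_i}\subset\mathbb{R}^{\Delta_i}$ is the set of all points that can be extracted from $\mathcal{M}_d^{\Delta_i}(y^* )$, i.e. that belong to an atomic representing support for $\mathcal{M}_d^{\Delta_i}(y^* )$. With $\delta_k=\{k\}$, $\mathcal{V}_k\subset\mathbb{R}$ is the set of all points that can be extracted from $\mathcal{M}_d^{\delta_k}(y^* )$, i.e. that belong to an atomic representing support for $\mathcal{M}_d^{\delta_k}(y^* )$. *)

theory Defs
  imports "HOL-Analysis.Analysis" "HOL-Analysis.Finite_Function_Topology"
begin

section \<open>Polynomials in the variables indexed by a finite type\<close>

type_synonym 'n exponent = "'n \<Rightarrow>\<^sub>0 nat"
type_synonym 'n mpoly = "'n exponent \<Rightarrow>\<^sub>0 real"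

definition exp_degree :: "'n exponent \<Rightarrow> nat"
  where "exp_degree \<alpha> = (\<Sum>j\<in>Poly_Mapping.keys \<alpha>. Poly_Mapping.lookup \<alpha> j)"

definition monomial_at :: "('n \<Rightarrow> real) \<Rightarrow> 'n exponent \<Rightarrow> real"
  where "monomial_at x \<alpha> = (\<Prod>j\<in>Poly_Mapping.keys \<alpha>. x j ^ Poly_Mapping.lookup \<alpha> j)"

definition poly_at :: "'n mpoly \<Rightarrow> ('n \<Rightarrow> real) \<Rightarrow> real"
  where "poly_at p x =
    (\<Sum>\<alpha>\<in>Poly_Mapping.keys p. Poly_Mapping.lookup p \<alpha> * monomial_at x \<alpha>)"

text \<open>The zero polynomial has total degree 0 by convention.\<close>

definition total_degree :: "'n mpoly \<Rightarrow> nat"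
  where "total_degree p = Max (insert 0 (exp_degree ` Poly_Mapping.keys p))"

definition polys_in :: "'n set \<Rightarrow> 'n mpoly set"
  where "polys_in \<Delta> = {p. \<forall>\<alpha>\<in>Poly_Mapping.keys p. Poly_Mapping.keys \<alpha> \<subseteq> \<Delta>}"

section \<open>Matrices indexed by a finite set\<close>

text \<open>
  The index sets of moment matrices depend on a relaxation order and on a set of variables,
  so a matrix is a function of two indices together with its (finite) index set; values at
  other indices are irrelevant.
\<close>

definition psd_on :: "'i set \<Rightarrow> ('i \<Rightarrow> 'i \<Rightarrow> real) \<Rightarrow> bool"
  where "psd_on I A \<longleftrightarrow>
    (\<forall>i\<in>I. \<forall>j\<in>I. A i j = A j i) \<and>
    (\<forall>v :: 'i \<Rightarrow> real. 0 \<le> (\<Sum>i\<in>I. \<Sum>j\<in>I. v i * A i j * v j))"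

text \<open>
  A row is encoded as the finitely supported vector with entry \<open>A i j\<close> at each \<open>j \<in> I\<close>
  and 0 elsewhere; as for \<^const>\<open>rank\<close>, the rank is the dimension of the span of the rows.
\<close>

definition row_on :: "'i set \<Rightarrow> ('i \<Rightarrow> 'i \<Rightarrow> real) \<Rightarrow> 'i \<Rightarrow> ('i \<Rightarrow>\<^sub>0 real)"
  where "row_on I A i = (\<Sum>j\<in>I. Poly_Mapping.single j (A i j))"

definition rank_on :: "'i set \<Rightarrow> ('i \<Rightarrow> 'i \<Rightarrow> real) \<Rightarrow> nat"
  where "rank_on I A = dim (row_on I A ` I)"

lemma lookup_row_on:
  assumes "finite I"
  shows "Poly_Mapping.lookup (row_on I A i) j = (if j \<in> I then A i j else 0)"
  using assms by (simp add: row_on_def lookup_sum lookup_single when_def)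

section \<open>Moment matrices and atomic representing supports\<close>

definition exponents :: "'n set \<Rightarrow> nat \<Rightarrow> 'n exponent set"
  where "exponents \<Delta> k = {\<alpha>. Poly_Mapping.keys \<alpha> \<subseteq> \<Delta> \<and> exp_degree \<alpha> \<le> k}"

lemma finite_exponents:
  fixes \<Delta> :: "'n::finite set"
  shows "finite (exponents \<Delta> k)"
proof -
  have "Poly_Mapping.lookup ` exponents \<Delta> k \<subseteq> (UNIV :: 'n set) \<rightarrow>\<^sub>E {..k}"
  proof
    fix g assume "g \<in> Poly_Mapping.lookup ` exponents \<Delta> k"
    then obtain \<alpha> where \<alpha>: "g = Poly_Mapping.lookup \<alpha>" "exp_degree \<alpha> \<le> k"
      by (auto simp: exponents_def)
    have "Poly_Mapping.lookup \<alpha> j \<le> k" for j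
    proof (cases "j \<in> Poly_Mapping.keys \<alpha>")
      case True
      then have "Poly_Mapping.lookup \<alpha> j \<le> exp_degree \<alpha>"
        unfolding exp_degree_def by (intro member_le_sum) auto
      with \<alpha> show ?thesis by simp
    qed (simp add: in_keys_iff)
    with \<alpha> show "g \<in> UNIV \<rightarrow>\<^sub>E {..k}" by auto
  qed
  then have "finite (Poly_Mapping.lookup ` exponents \<Delta> k)"
    by (rule finite_subset) (simp add: finite_PiE)
  moreover have "inj_on Poly_Mapping.lookup (exponents \<Delta> k)"
    by (simp add: inj_on_def)
  ultimately show ?thesis by (rule finite_imageD)
qed

definition moment_matrix :: "('n exponent \<Rightarrow> real) \<Rightarrow> 'n exponent \<Rightarrow> 'n exponent \<Rightarrow> real"
  where "moment_matrix y \<alpha> \<beta> = y (\<alpha> + \<beta>)"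

definition flat_extension :: "nat \<Rightarrow> 'n set \<Rightarrow> ('n exponent \<Rightarrow> real) \<Rightarrow> bool"
  where "flat_extension d \<Delta> y \<longleftrightarrow>
    (\<exists>k. k + 1 \<le> d \<and>
      rank_on (exponents \<Delta> k) (moment_matrix y) =
      rank_on (exponents \<Delta> (k + 1)) (moment_matrix y))"

text \<open>Points of \<open>\<real>\<^sup>\<Delta>\<close> are the functions in \<open>\<Delta> \<rightarrow>\<^sub>E UNIV\<close>.\<close>

definition atomic_support ::
    "nat \<Rightarrow> 'n set \<Rightarrow> ('n exponent \<Rightarrow> real) \<Rightarrow> ('n \<Rightarrow> real) set \<Rightarrow> bool"
  where "atomic_support d \<Delta> y U \<longleftrightarrow>
    finite U \<and> U \<subseteq> \<Delta> \<rightarrow>\<^sub>E UNIV \<and>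
    (\<exists>c. (\<forall>u\<in>U. 0 < c u) \<and> (\<Sum>u\<in>U. c u) = 1 \<and>
      (\<forall>\<alpha>\<in>exponents \<Delta> d. \<forall>\<beta>\<in>exponents \<Delta> d.
        moment_matrix y \<alpha> \<beta> = (\<Sum>u\<in>U. c u * (monomial_at u \<alpha> * monomial_at u \<beta>))))"

definition extracted_points :: "nat \<Rightarrow> 'n set \<Rightarrow> ('n exponent \<Rightarrow> real) \<Rightarrow> ('n \<Rightarrow> real) set"
  where "extracted_points d \<Delta> y = \<Union> {U. atomic_support d \<Delta> y U}"

text \<open>Here \<open>\<real>\<^bsup>{k}\<^esup>\<close> is identified with \<open>\<real>\<close>.\<close>

definition extracted_values :: "nat \<Rightarrow> 'n \<Rightarrow> ('n exponent \<Rightarrow> real) \<Rightarrow> real set"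
  where "extracted_values d k y = (\<lambda>u. u k) ` extracted_points d {k} y"

section \<open>The sparse moment relaxation\<close>

definition sparse_exponents :: "nat \<Rightarrow> nat \<Rightarrow> (nat \<Rightarrow> 'n set) \<Rightarrow> 'n exponent set"
  where "sparse_exponents d m \<Delta> = (\<Union>i\<in>{1..m}. exponents (\<Delta> i) (2 * d))"

definition relaxation_objective ::
    "nat \<Rightarrow> nat \<Rightarrow> (nat \<Rightarrow> 'n set) \<Rightarrow> 'n mpoly \<Rightarrow> ('n exponent \<Rightarrow> real) \<Rightarrow> real"
  where "relaxation_objective d m \<Delta> f y =
    (\<Sum>\<alpha>\<in>sparse_exponents d m \<Delta>. Poly_Mapping.lookup f \<alpha> * y \<alpha>)"

definition relaxation_feasible ::
    "nat \<Rightarrow> nat \<Rightarrow> (nat \<Rightarrow> 'n set) \<Rightarrow> ('n exponent \<Rightarrow> real) \<Rightarrow> bool"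
  where "relaxation_feasible d m \<Delta> y \<longleftrightarrow>
    y \<in> sparse_exponents d m \<Delta> \<rightarrow>\<^sub>E UNIV \<and>
    (\<forall>i\<in>{1..m}. psd_on (exponents (\<Delta> i) d) (moment_matrix y)) \<and>
    y 0 = 1"

end

theory Submission
  imports Defs
begin

text \<open>
  Any point \<open>x\<close> whose projections are atoms of representing measures of all the moment matrices
  can be split off: for small \<open>t > 0\<close> the sequence \<open>(y - t m(x)) / (1 - t)\<close> is still feasible, where
  \<open>m(x)\<close> is the sequence of monomials at \<open>x\<close>. Optimality of \<open>y\<close> then gives \<open>f(x) \<le> L\<^sub>y(f)\<close>. As every
  \<open>m(z)\<close> is feasible with objective value \<open>f(z)\<close>, also \<open>L\<^sub>y(f) \<le> f(z)\<close> for all \<open>z\<close>.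
\<close>

text \<open>Passing to an index set independent of the exponent only inserts factors
  \<open>x j ^ 0 = 1\<close>, also when \<open>x j = 0\<close>. Multiplicativity in the exponent
  then holds factor by factor.\<close>

lemma monomial_at_UNIV:
  fixes x :: "'n::finite \<Rightarrow> real"
  shows "monomial_at x \<alpha> = (\<Prod>j\<in>UNIV. x j ^ Poly_Mapping.lookup \<alpha> j)"
  unfolding monomial_at_def by (rule prod.mono_neutral_left) (auto simp: in_keys_iff)

lemma exp_degree_UNIV:
  fixes \<alpha> :: "'n::finite exponent"
  shows "exp_degree \<alpha> = (\<Sum>j\<in>UNIV. Poly_Mapping.lookup \<alpha> j)"
  unfolding exp_degree_def by (rule sum.mono_neutral_left) (auto simp: in_keys_iff)

lemma monomial_at_0 [simp]: "monomial_at x 0 = 1"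
  by (simp add: monomial_at_def)

lemma monomial_at_add:
  fixes x :: "'n::finite \<Rightarrow> real"
  shows "monomial_at x (\<alpha> + \<beta>) = monomial_at x \<alpha> * monomial_at x \<beta>"
  by (simp add: monomial_at_UNIV lookup_add power_add prod.distrib)

text \<open>Off \<Delta> the restricted point is \<open>undefined\<close>, but a monomial reads only
  the coordinates in its keys.\<close>

lemma monomial_at_restrict:
  assumes "Poly_Mapping.keys \<alpha> \<subseteq> \<Delta>"
  shows "monomial_at (restrict x \<Delta>) \<alpha> = monomial_at x \<alpha>"
  unfolding monomial_at_def using assms by (intro prod.cong) auto

lemma exponents_add:
  fixes \<alpha> \<beta> :: "'n::finite exponent"
  assumes "\<alpha> \<in> exponents \<Delta> k" "\<beta> \<in> exponents \<Delta> l"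
  shows "\<alpha> + \<beta> \<in> exponents \<Delta> (k + l)"
proof -
  have "exp_degree (\<alpha> + \<beta>) = exp_degree \<alpha> + exp_degree \<beta>"
    by (simp add: exp_degree_UNIV lookup_add sum.distrib)
  then show ?thesis
    using assms keys_add[of \<alpha> \<beta>] unfolding exponents_def by fastforce
qed

text \<open>The moment matrices thus read a sequence only on
  \<open>sparse_exponents d m \<Delta>\<close>, so cutting it off there with \<open>restrict\<close>
  does not change their entries.\<close>

lemma exponents_add_sparse:
  fixes \<Delta> :: "nat \<Rightarrow> 'n::finite set"
  assumes "i \<in> {1..m}" "\<alpha> \<in> exponents (\<Delta> i) d" "\<beta> \<in> exponents (\<Delta> i) d"
  shows "\<alpha> + \<beta> \<in> sparse_exponents d m \<Delta>"
  using exponents_add[OF assms(2,3)] assms(1) by (auto simp: sparse_exponents_def mult_2)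

lemma finite_sparse_exponents:
  fixes \<Delta> :: "nat \<Rightarrow> 'n::finite set"
  shows "finite (sparse_exponents d m \<Delta>)"
  by (simp add: sparse_exponents_def finite_exponents)

lemma zero_in_sparse_exponents: "1 \<le> m \<Longrightarrow> 0 \<in> sparse_exponents d m \<Delta>"
  by (auto simp: sparse_exponents_def exponents_def exp_degree_def)

lemma keys_subset_exponents:
  assumes "p \<in> polys_in \<Delta>" "total_degree p \<le> k"
  shows "Poly_Mapping.keys p \<subseteq> exponents \<Delta> k"
  using assms by (auto simp: polys_in_def total_degree_def exponents_def)

lemma quadratic_form_rank_one:
  fixes g v :: "'i \<Rightarrow> real"
  shows "(\<Sum>i\<in>I. \<Sum>j\<in>I. v i * (g i * g j) * v j) = (\<Sum>i\<in>I. v i * g i)\<^sup>2"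
  by (simp add: power2_eq_square sum_product algebra_simps)

lemma psd_on_rank_one: "psd_on I (\<lambda>i j. g i * g j)"
  unfolding psd_on_def quadratic_form_rank_one by (simp add: mult.commute)

lemma psd_on_scale:
  assumes "psd_on I A" "0 \<le> c"
  shows "psd_on I (\<lambda>i j. c * A i j)"
proof -
  have "(\<Sum>i\<in>I. \<Sum>j\<in>I. v i * (c * A i j) * v j) = c * (\<Sum>i\<in>I. \<Sum>j\<in>I. v i * A i j * v j)"
    for v by (simp add: sum_distrib_left ac_simps)
  then show ?thesis using assms by (simp add: psd_on_def)
qed

lemma psd_on_cong:
  assumes "\<And>i j. i \<in> I \<Longrightarrow> j \<in> I \<Longrightarrow> A i j = B i j"
  shows "psd_on I A \<longleftrightarrow> psd_on I B"
  using assms by (simp add: psd_on_def cong: sum.cong)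

text \<open>The quadratic form equals the sum of \<open>c u * q u\<close> minus
  \<open>t * q w\<close>, where each \<open>q u\<close> is a square. The summand at \<open>w\<close>
  alone already dominates \<open>t * q w\<close>, and the others are nonnegative.\<close>

lemma psd_on_sum_rank_one_diff:
  fixes g :: "'u \<Rightarrow> 'i \<Rightarrow> real"
  assumes "finite U" "w \<in> U" "\<And>u. u \<in> U \<Longrightarrow> 0 \<le> c u" "t \<le> c w"
  shows "psd_on I (\<lambda>i j. (\<Sum>u\<in>U. c u * (g u i * g u j)) - t * (g w i * g w j))"
    (is "psd_on I ?A")
proof -
  have "0 \<le> (\<Sum>i\<in>I. \<Sum>j\<in>I. v i * ?A i j * v j)" for v
  proof -
    define q where "q u = (\<Sum>i\<in>I. v i * g u i)\<^sup>2" for u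
    have q: "q u = (\<Sum>i\<in>I. \<Sum>j\<in>I. v i * (g u i * g u j) * v j)" for u
      by (simp add: q_def quadratic_form_rank_one)
    have "(\<Sum>i\<in>I. \<Sum>j\<in>I. v i * (\<Sum>u\<in>U. c u * (g u i * g u j)) * v j)
        = (\<Sum>i\<in>I. \<Sum>j\<in>I. \<Sum>u\<in>U. c u * (v i * (g u i * g u j) * v j))"
      by (intro sum.cong refl) (simp add: sum_distrib_left sum_distrib_right mult.left_commute mult.assoc)
    also have "\<dots> = (\<Sum>i\<in>I. \<Sum>u\<in>U. \<Sum>j\<in>I. c u * (v i * (g u i * g u j) * v j))"
      by (intro sum.cong refl sum.swap)
    also have "\<dots> = (\<Sum>u\<in>U. \<Sum>i\<in>I. \<Sum>j\<in>I. c u * (v i * (g u i * g u j) * v j))"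
      by (rule sum.swap)
    also have "\<dots> = (\<Sum>u\<in>U. c u * q u)"
      unfolding q by (simp only: sum_distrib_left)
    finally have "(\<Sum>i\<in>I. \<Sum>j\<in>I. v i * ?A i j * v j) = (\<Sum>u\<in>U. c u * q u) - t * q w"
      unfolding q[of w]
      by (simp add: algebra_simps sum_subtractf sum_distrib_left)
    moreover have "t * q w \<le> c w * q w"
      using assms(4) by (simp add: q_def mult_right_mono)
    moreover have "c w * q w \<le> (\<Sum>u\<in>U. c u * q u)"
      using assms(1-3) by (intro member_le_sum) (auto simp: q_def)
    ultimately show ?thesis by linarith
  qed
  then show ?thesis by (simp add: psd_on_def mult.commute)
qed

text \<open>The bound \<open>c\<close> is the weight of the atom \<open>restrict x \<Delta>\<close>
  in a representing support that contains it.\<close>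

lemma extracted_point_split:
  assumes "restrict x \<Delta> \<in> extracted_points d \<Delta> y"
  obtains c where "0 < c"
    and "\<And>t. t \<le> c \<Longrightarrow> psd_on (exponents \<Delta> d)
      (\<lambda>\<alpha> \<beta>. moment_matrix y \<alpha> \<beta> - t * (monomial_at x \<alpha> * monomial_at x \<beta>))"
proof -
  define w where "w = restrict x \<Delta>"
  from assms obtain U c where U: "w \<in> U" "finite U" "\<And>u. u \<in> U \<Longrightarrow> 0 < c u"
    and M: "\<And>\<alpha> \<beta>. \<alpha> \<in> exponents \<Delta> d \<Longrightarrow> \<beta> \<in> exponents \<Delta> d \<Longrightarrow>
      moment_matrix y \<alpha> \<beta> = (\<Sum>u\<in>U. c u * (monomial_at u \<alpha> * monomial_at u \<beta>))"
    unfolding extracted_points_def atomic_support_def w_def by blast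
  have w: "monomial_at w \<alpha> = monomial_at x \<alpha>" if "\<alpha> \<in> exponents \<Delta> d" for \<alpha>
    using that by (simp add: w_def exponents_def monomial_at_restrict)
  show thesis
  proof (rule that[of "c w"])
    fix t assume "t \<le> c w"
    then have "psd_on (exponents \<Delta> d) (\<lambda>\<alpha> \<beta>. (\<Sum>u\<in>U. c u * (monomial_at u \<alpha> * monomial_at u \<beta>))
        - t * (monomial_at w \<alpha> * monomial_at w \<beta>))"
      using U by (intro psd_on_sum_rank_one_diff) (auto intro: less_imp_le)
    then show "psd_on (exponents \<Delta> d)
        (\<lambda>\<alpha> \<beta>. moment_matrix y \<alpha> \<beta> - t * (monomial_at x \<alpha> * monomial_at x \<beta>))"
      by (rule psd_on_cong[THEN iffD1, rotated]) (simp add: M w)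
  qed (use U in auto)
qed

text \<open>These are the moments of the Dirac measure at \<open>z\<close>: multiplicativity of
  monomials makes every moment matrix the rank one matrix of the vector of monomials at
  \<open>z\<close>.\<close>

lemma relaxation_feasible_monomials:
  fixes \<Delta> :: "nat \<Rightarrow> 'n::finite set"
  assumes "1 \<le> m"
  shows "relaxation_feasible d m \<Delta> (restrict (monomial_at z) (sparse_exponents d m \<Delta>))"
    (is "relaxation_feasible _ _ _ ?y")
proof -
  have "psd_on (exponents (\<Delta> i) d) (moment_matrix ?y)" if "i \<in> {1..m}" for i
    by (rule psd_on_cong[THEN iffD1, rotated, OF psd_on_rank_one[of _ "monomial_at z"]])
      (simp add: moment_matrix_def monomial_at_add exponents_add_sparse[OF that])
  then show ?thesis
    using zero_in_sparse_exponents[OF assms, of d \<Delta>] by (simp add: relaxation_feasible_def)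
qed

lemma relaxation_objective_monomials:
  fixes \<Delta> :: "nat \<Rightarrow> 'n::finite set"
  assumes "Poly_Mapping.keys f \<subseteq> sparse_exponents d m \<Delta>"
  shows "relaxation_objective d m \<Delta> f (restrict (monomial_at z) (sparse_exponents d m \<Delta>)) = poly_at f z"
  unfolding relaxation_objective_def poly_at_def using assms
  by (intro sum.mono_neutral_cong_right)
    (auto simp: finite_sparse_exponents in_keys_iff)

theorem theorem3p10:
  fixes m d :: nat
    and \<Delta> :: "nat \<Rightarrow> 'n::finite set"
    and ds :: "nat \<Rightarrow> nat"
    and fs :: "nat \<Rightarrow> 'n mpoly"
    and f :: "'n mpoly"
    and y :: "'n exponent \<Rightarrow> real"
    and x :: "real ^ 'n"
  assumes cover: "(\<Union>i\<in>{1..m}. \<Delta> i) = UNIV"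
    and fs_in: "\<And>i. i \<in> {1..m} \<Longrightarrow> fs i \<in> polys_in (\<Delta> i)"
    and fs_degree: "\<And>i. i \<in> {1..m} \<Longrightarrow> total_degree (fs i) = 2 * ds i"
    and f_sum: "f = (\<Sum>i\<in>{1..m}. fs i)"
    and f_degree: "total_degree f = 2 * d"
    and d_max: "2 * d = Max ((\<lambda>i. 2 * ds i) ` {1..m})"
    and optimal: "is_arg_min (relaxation_objective d m \<Delta> f) (relaxation_feasible d m \<Delta>) y"
    and flat: "\<And>i. i \<in> {1..m} \<Longrightarrow> flat_extension d (\<Delta> i) y"
    and values_in: "\<And>k. x $ k \<in> extracted_values d k y"
    and points_in: "\<And>i. i \<in> {1..m} \<Longrightarrow> restrict (($) x) (\<Delta> i) \<in> extracted_points d (\<Delta> i) y"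
  shows "is_arg_min (\<lambda>z. poly_at f (($) z)) (\<lambda>_. True) x"
proof -
  define S where "S = sparse_exponents d m \<Delta>"
  define L where "L = relaxation_objective d m \<Delta> f"
  \<comment> \<open>An empty union cannot cover a type, as types are inhabited.\<close>
  have m: "1 \<le> m"
    using cover by (cases m) auto
  \<comment> \<open>The inclusion is shown for each summand, because the variables of a monomial of
    \<open>f\<close> lie in a common block only through the decomposition.\<close>
  have "Poly_Mapping.keys (fs i) \<subseteq> S" if "i \<in> {1..m}" for i
  proof -
    have "2 * ds i \<le> 2 * d"
      unfolding d_max using that by (intro Max_ge) auto
    with that show ?thesis
      using keys_subset_exponents[OF fs_in[OF that], of "2 * d"] fs_degree[OF that]
      by (auto simp: S_def sparse_exponents_def)
  qed
  then have keys_f: "Poly_Mapping.keys f \<subseteq> S"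
    using keys_sum[of fs "{1..m}"] unfolding f_sum by blast
  have feas: "relaxation_feasible d m \<Delta> y"
    and opt: "\<And>y'. relaxation_feasible d m \<Delta> y' \<Longrightarrow> L y \<le> L y'"
    using optimal by (auto simp: is_arg_min_def L_def not_less)
  have L_le: "L y \<le> poly_at f z" for z
    using opt[OF relaxation_feasible_monomials[OF m]] keys_f
    by (simp add: L_def S_def relaxation_objective_monomials)
  define mx where "mx = monomial_at (($) x)"
  \<comment> \<open>What remains of the moment matrices after mass \<open>t\<close> at
    \<open>x\<close> is removed.\<close>
  define M where "M t = (\<lambda>\<alpha> \<beta>. moment_matrix y \<alpha> \<beta> - t * (mx \<alpha> * mx \<beta>))" for t
  have "\<exists>c>0. \<forall>t\<le>c. psd_on (exponents (\<Delta> i) d) (M t)" if "i \<in> {1..m}" for i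
    by (rule extracted_point_split[OF points_in[OF that]]) (auto simp: M_def mx_def)
  then obtain c where c: "\<And>i. i \<in> {1..m} \<Longrightarrow> 0 < c i"
    and psd: "\<And>i t. i \<in> {1..m} \<Longrightarrow> t \<le> c i \<Longrightarrow> psd_on (exponents (\<Delta> i) d) (M t)"
    by metis
  \<comment> \<open>One mass that can be removed from all blocks at once; the entry
    \<open>1 / 2\<close> keeps \<open>1 - t\<close> positive.\<close>
  define t where "t = Min (insert (1 / 2) (c ` {1..m}))"
  have t: "0 < t" "t < 1" "\<And>i. i \<in> {1..m} \<Longrightarrow> t \<le> c i"
  proof -
    show "0 < t" using c by (auto simp: t_def)
    have "t \<le> 1 / 2" unfolding t_def by (rule Min_le) auto
    then show "t < 1" by simp
    show "t \<le> c i" if "i \<in> {1..m}" for i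
      unfolding t_def using that by (intro Min_le) auto
  qed
  \<comment> \<open>Chosen so that \<open>y = t * mx + (1 - t) * y'\<close> on \<open>S\<close>;
    dividing by \<open>1 - t\<close> restores the normalisation at 0.\<close>
  define y' where "y' = restrict (\<lambda>\<alpha>. inverse (1 - t) * (y \<alpha> - t * mx \<alpha>)) S"
  have "psd_on (exponents (\<Delta> i) d) (moment_matrix y')" if "i \<in> {1..m}" for i
  proof (rule psd_on_cong[THEN iffD1, rotated])
    show "psd_on (exponents (\<Delta> i) d) (\<lambda>\<alpha> \<beta>. inverse (1 - t) * M t \<alpha> \<beta>)"
      using psd t that by (intro psd_on_scale) auto
  qed (simp add: y'_def M_def S_def mx_def moment_matrix_def monomial_at_add
        exponents_add_sparse[OF that])
  moreover have "y' 0 = 1"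
    using feas t zero_in_sparse_exponents[OF m, of d \<Delta>]
    by (simp add: y'_def S_def mx_def relaxation_feasible_def)
  ultimately have "relaxation_feasible d m \<Delta> y'"
    by (simp add: relaxation_feasible_def y'_def S_def)
  then have "L y \<le> L y'" by (rule opt)
  \<comment> \<open>The objective is linear in the values on \<open>S\<close>.\<close>
  also have "L y' = inverse (1 - t) * (L y - t * L (restrict mx S))"
    unfolding L_def relaxation_objective_def y'_def S_def
    by (simp add: sum_distrib_left algebra_simps sum_subtractf)
  also have "L (restrict mx S) = poly_at f (($) x)"
    using keys_f by (simp add: L_def S_def mx_def relaxation_objective_monomials)
  finally have "(1 - t) * L y \<le> L y - t * poly_at f (($) x)"
    using t by (simp add: field_simps)
  then have "t * poly_at f (($) x) \<le> t * L y"
    by (simp add: algebra_simps)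
  then have "poly_at f (($) x) \<le> L y"
    using t by simp
  \<comment> \<open>The value at \<open>x\<close> is at most \<open>L y\<close>, which is a lower
    bound for \<open>f\<close> everywhere.\<close>
  with L_le show ?thesis
    by (auto simp: is_arg_min_def not_less intro: order_trans)
qed

end
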